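(* Let $k\ge2$, let $\mathrm{SWAP}=\langle 0000|+\langle 0101|+\langle 1010|+\langle 1111|\in((\mathbb{C}^2)^* )^{\otimes4}$ and let $G=\mathrm{SWAP}^{\otimes k}\in((\mathbb{C}^2)^* )^{\otimes 4k}$. Then $$P_{W_{4k}}\bigl(\overline{\mathrm{SL}(2,\mathbb{C})^{4k}.G}\bigr)\cap\mathbb{C}\mathcal{P}_{4k}^\vee=P_{W_{4k}}\bigl(\mathrm{GL}(2,\mathbb{C})^{4k}.G\bigr)\cap\mathbb{C}^*\mathcal{P}_{4k}^\vee=\emptyset.$$
   Context: Notation: $\{v_0,v_1\}$ is an orthonormal basis of $\mathbb{C}^2$ with dual basis $\{v_0^*,v_1^*\}$; $\langle i_1\cdots i_k|=v_{i_1}^*\otimes\cdots\otimes v_{i_k}^*$. For $I\subseteq[n]=\{1,\dots,n\}$, $\langle I|=\langle\chi_I(1)\cdots\chi_I(n)|$ where $\chi_I$ is the indicator function of $I$, and $\overline I=[n]\setminus I$. For an $n\times n$ skew-symmetric complex matrix $M$ let $M_I$ be the principal submatrix with rows and columns in $I$ and put $$\mathrm{sPf}^\vee_n(M)=\sum_{I\subseteq[n]}\mathrm{Pf}(M_I)\,\langle\overline I|\in((\mathbb{C}^2)^* )^{\otimes n},$$ where $\mathrm{Pf}$ of the empty matrix is $1$ and $\mathrm{Pf}$ of an odd-size matrix is $0$. $\mathcal{P}_n^\vee$ is the image of $\mathrm{sPf}_n^\vee$ (the variety of arity-$n$ Pfaffian cogates). $\mathbb{C}\mathcal{P}_n^\vee$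 denotes the cone over $\mathcal{P}_n^\vee$, i.e. the affine variety defined by the homogeneous (Grassmann–Plücker type) relations defining $\mathcal{P}_n^\vee$ with the normalization that the coefficient of $\langle 1\cdots1|$ equals $1$ omitted; and $\mathbb{C}^*\mathcal{P}_n^\vee=\{\lambda p:\lambda\in\mathbb{C}\setminus\{0\},\ p\in\mathcal{P}_n^\vee\}$. $(g_1,\dots,g_n)\in\mathrm{GL}(2,\mathbb{C})^n$ (in particular in $\mathrm{SL}(2,\mathbb{C})^n$) acts on $((\mathbb{C}^2)^* )^{\otimes n}$ by $\phi\mapsto\phi\circ(g_1^{-1}\otimes\cdots\otimes g_n^{-1})$; the overline on an orbit denotes Zariski closure. $W_n\subset((\mathbb{C}^2)^* )^{\otimes n}$ is the subspace of tensors of even support, i.e. $\sum_{I\subseteq[n]}\beta_I\langle I|$ with $\beta_I=0$ whenever $|I|$ is odd, and $P_{W_n}:((\mathbb{C}^2)^* )^{\otimes n}\to W_n$ is the associated linear projector $\sum_I\beta_I\langle I|\mapsto\sum_{|I|\text{ even}}\beta_I\langle I|$.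
   Formalization: The first intersection is taken with the cone minus the zero tensor: as stated it contains 0, since the cone is homogeneous and acting on G by a quarter turn in SL(2) on one factor gives a tensor of odd support, whose projection is 0. *)

theory Defs
  imports "HOL-Analysis.Analysis"
begin

(* An n-fold tensor of covectors of C^2 is given by its coordinates: t stands for the sum of
   t I <I| over I \<subseteq> {1..n}, and t vanishes on every other set. *)
type_synonym tensor = "nat set \<Rightarrow> complex"

definition tensor_space :: "nat \<Rightarrow> tensor set" where
  "tensor_space n = {t. \<forall>I. \<not> I \<subseteq> {1..n} \<longrightarrow> t I = 0}"

definition bra :: "nat set \<Rightarrow> tensor" where
  "bra I = (\<lambda>J. of_bool (J = I))"

(* <i_1 ... i_n| for a bit string: i_j is the list entry of index j - 1. *)
definition bra_bits :: "nat list \<Rightarrow> tensor" where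
  "bra_bits w = bra {i \<in> {1..length w}. w ! (i - 1) = 1}"

(* \<phi> has arity m; the factors of \<psi> are renumbered to start at m + 1. *)
definition tensor_prod :: "nat \<Rightarrow> tensor \<Rightarrow> tensor \<Rightarrow> tensor" where
  "tensor_prod m \<phi> \<psi> = (\<lambda>I. \<phi> (I \<inter> {..m}) * \<psi> ((\<lambda>i. i - m) ` (I - {..m})))"

primrec tensor_power :: "nat \<Rightarrow> tensor \<Rightarrow> nat \<Rightarrow> tensor" where
  "tensor_power m \<phi> 0 = bra {}"
| "tensor_power m \<phi> (Suc k) = tensor_prod m \<phi> (tensor_power m \<phi> k)"

definition SWAP :: tensor where
  "SWAP = (\<lambda>J. bra_bits [0,0,0,0] J + bra_bits [0,1,0,1] J
             + bra_bits [1,0,1,0] J + bra_bits [1,1,1,1] J)"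

definition even_proj :: "tensor \<Rightarrow> tensor" where
  "even_proj t = (\<lambda>I. if even (card I) then t I else 0)"


(* The two elements 0 and 1 of the index type 2 stand for v_0 and v_1. *)
definition GL2 :: "(complex^2^2) set" where
  "GL2 = {A. invertible A}"

definition SL2 :: "(complex^2^2) set" where
  "SL2 = {A. det A = 1}"

(* \<phi> \<circ> (g_1^{-1} \<otimes> ... \<otimes> g_n^{-1}), evaluated on the basis vector indexed by I. *)
definition act :: "nat \<Rightarrow> (nat \<Rightarrow> complex^2^2) \<Rightarrow> tensor \<Rightarrow> tensor" where
  "act n g \<phi> = (\<lambda>I. if I \<subseteq> {1..n} then
     \<Sum>J\<in>Pow {1..n}. \<phi> J * (\<Prod>i\<in>{1..n}. matrix_inv (g i) $ of_bool (i \<in> J) $ of_bool (i \<in> I))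
     else 0)"

definition orbit :: "nat \<Rightarrow> (complex^2^2) set \<Rightarrow> tensor \<Rightarrow> tensor set" where
  "orbit n H \<phi> = {act n g \<phi> | g. \<forall>i\<in>{1..n}. g i \<in> H}"


inductive poly_fun :: "nat \<Rightarrow> (tensor \<Rightarrow> complex) \<Rightarrow> bool" for n where
  const: "poly_fun n (\<lambda>t. c)"
| coord: "I \<subseteq> {1..n} \<Longrightarrow> poly_fun n (\<lambda>t. t I)"
| add: "poly_fun n f \<Longrightarrow> poly_fun n g \<Longrightarrow> poly_fun n (\<lambda>t. f t + g t)"
| mult: "poly_fun n f \<Longrightarrow> poly_fun n g \<Longrightarrow> poly_fun n (\<lambda>t. f t * g t)"

inductive hom_poly_fun :: "nat \<Rightarrow> nat \<Rightarrow> (tensor \<Rightarrow> complex) \<Rightarrow> bool" for n where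
  const: "hom_poly_fun n 0 (\<lambda>t. c)"
| coord: "I \<subseteq> {1..n} \<Longrightarrow> hom_poly_fun n 1 (\<lambda>t. t I)"
| add: "hom_poly_fun n d f \<Longrightarrow> hom_poly_fun n d g \<Longrightarrow> hom_poly_fun n d (\<lambda>t. f t + g t)"
| mult: "hom_poly_fun n d f \<Longrightarrow> hom_poly_fun n e g \<Longrightarrow> hom_poly_fun n (d + e) (\<lambda>t. f t * g t)"

definition zariski_closure :: "nat \<Rightarrow> tensor set \<Rightarrow> tensor set" where
  "zariski_closure n X = {t \<in> tensor_space n.
     \<forall>f. poly_fun n f \<longrightarrow> (\<forall>x\<in>X. f x = 0) \<longrightarrow> f t = 0}"


(* Pfaffian of the principal submatrix of M on the listed indices, by expansion along the
   first row. *)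
function pfaffian :: "(nat \<Rightarrow> nat \<Rightarrow> complex) \<Rightarrow> nat list \<Rightarrow> complex" where
  "pfaffian M [] = 1"
| "pfaffian M (x # xs) =
     (\<Sum>j<length xs. (-1) ^ j * M x (xs ! j) * pfaffian M (take j xs @ drop (Suc j) xs))"
  by pat_completeness auto
termination by (relation "Wellfounded.measure (\<lambda>(M, xs). length xs)") auto

lemma pfaffian_odd: "odd (length xs) \<Longrightarrow> pfaffian M xs = 0"
proof (induction xs rule: length_induct)
  case (1 xs)
  then show ?case by (cases xs) (auto intro!: sum.neutral)
qed

lemma pfaffian_4:
  "pfaffian M [a, b, c, d] = M a b * M c d - M a c * M b d + M a d * M b c"
  by (simp add: lessThan_Suc)

definition skew_symmetric :: "nat \<Rightarrow> (nat \<Rightarrow> nat \<Rightarrow> complex) \<Rightarrow> bool" where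
  "skew_symmetric n M \<longleftrightarrow> (\<forall>i\<in>{1..n}. \<forall>j\<in>{1..n}. M i j = - M j i)"

definition sPf_dual :: "nat \<Rightarrow> (nat \<Rightarrow> nat \<Rightarrow> complex) \<Rightarrow> tensor" where
  "sPf_dual n M = (\<lambda>J. \<Sum>I\<in>Pow {1..n}. pfaffian M (sorted_list_of_set I) * bra ({1..n} - I) J)"

definition pfaffian_cogates :: "nat \<Rightarrow> tensor set" where
  "pfaffian_cogates n = sPf_dual n ` {M. skew_symmetric n M}"

definition pfaffian_punctured_lines :: "nat \<Rightarrow> tensor set" where
  "pfaffian_punctured_lines n = {(\<lambda>I. c * p I) | c p. c \<noteq> 0 \<and> p \<in> pfaffian_cogates n}"

(* The affine variety cut out by all homogeneous relations holding on the Pfaffian cogates.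
   It contains the zero tensor. So does the even part of the SL2-orbit of any power k \<ge> 1 of
   SWAP: acting in position 1 by a quarter turn and trivially elsewhere makes the support odd.
   Emptiness of the intersection can therefore only be claimed away from zero. *)
definition pfaffian_cone :: "nat \<Rightarrow> tensor set" where
  "pfaffian_cone n = {t \<in> tensor_space n.
     \<forall>d f. hom_poly_fun n d f \<longrightarrow> (\<forall>p\<in>pfaffian_cogates n. f p = 0) \<longrightarrow> f t = 0}"

end

theory Submission
  imports Defs
begin

text \<open>
  SWAP is a product of two bilinear forms, one pairing positions 1 and 3 and one pairing positions
  2 and 4. Every tensor in the orbits, and by exchange relations and an \<open>SL2\<close>-invariant quadratic
  form also every tensor in the closure, is therefore a product of \<open>2 * k\<close> bilinear forms of nonzero
  determinant on these pairs of positions. Suppose the even part is nonzero and satisfies the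
  four-term Grassmann-Pluecker relations. Call a form mixed if it has both even and odd entries.
  If each of two different blocks contains a mixed form, take the partner of one of them: the four-term
  relation on its two positions, a position of the mixed form between them and a position of the
  other mixed form reads \<open>2 * det * nonzero = 0\<close>. Otherwise some block has no mixed form, and the
  four-term relation on that block has exactly two nonzero terms, which are equal and
  occur with the same sign.
\<close>

section \<open>Grassmann-Pluecker relations for Pfaffians\<close>

text \<open>For \<open>x\<close> in \<open>S\<close> this is the sign \<open>(-1) ^ j\<close> of the
  row expansion, with \<open>j\<close> the 0-based place of \<open>x\<close> in the sorted list of
  \<open>S\<close>. Allowing \<open>x\<close> outside \<open>S\<close> makes the sign multiplicative
  under symmetric difference.\<close>

definition pos_sign :: "nat \<Rightarrow> nat set \<Rightarrow> complex" where
  "pos_sign x S = (-1) ^ card {s \<in> S. s < x}"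

abbreviation ord_sign :: "nat \<Rightarrow> nat \<Rightarrow> complex" where
  "ord_sign y x \<equiv> (if y < x then -1 else 1)"

lemma pos_sign_empty [simp]: "pos_sign x {} = 1"
  by (simp add: pos_sign_def)

lemma pos_sign_insert:
  assumes "finite S" "y \<notin> S"
  shows "pos_sign x (insert y S) = ord_sign y x * pos_sign x S"
proof -
  have "{s \<in> insert y S. s < x} = (if y < x then insert y {s \<in> S. s < x} else {s \<in> S. s < x})"
    by auto
  then show ?thesis
    using assms by (simp add: pos_sign_def)
qed

lemma pos_sign_remove:
  assumes "finite S" "y \<in> S"
  shows "pos_sign x (S - {y}) = ord_sign y x * pos_sign x S"
  using pos_sign_insert[of "S - {y}" y x] assms by (simp add: insert_absorb)

lemma pos_sign_square: "pos_sign x S * pos_sign x S = 1"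
  by (simp add: pos_sign_def flip: power_mult_distrib)

lemma pos_sign_sym_diff:
  assumes "finite X" "finite Y"
  shows "pos_sign x (sym_diff X Y) = pos_sign x X * pos_sign x Y"
  using assms(2)
proof (induction Y)
  case empty
  then show ?case by (simp add: pos_sign_def)
next
  case (insert y Y)
  show ?case
  proof (cases "y \<in> X")
    case True
    then have eq: "sym_diff X (insert y Y) = sym_diff X Y - {y}" and "y \<in> sym_diff X Y"
      using insert by auto
    then show ?thesis
      unfolding eq using pos_sign_remove[of "sym_diff X Y" y x] insert assms
      by (simp add: pos_sign_insert)
  next
    case False
    then have eq: "sym_diff X (insert y Y) = insert y (sym_diff X Y)" and "y \<notin> sym_diff X Y"
      using insert by auto
    then show ?thesis
      unfolding eq using pos_sign_insert[of "sym_diff X Y" y x] insert assms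
      by (simp add: pos_sign_insert)
  qed
qed

definition pf :: "(nat \<Rightarrow> nat \<Rightarrow> complex) \<Rightarrow> nat set \<Rightarrow> complex" where
  "pf M S = pfaffian M (sorted_list_of_set S)"

lemma pf_insert_least:
  assumes "finite S" "\<And>s. s \<in> S \<Longrightarrow> m < s"
  shows "pf M (insert m S) = (\<Sum>y\<in>S. pos_sign y S * M m y * pf M (S - {y}))"
proof -
  define xs where "xs = sorted_list_of_set S"
  have xs: "sorted_wrt (<) xs" "distinct xs" "set xs = S"
    using assms(1) by (simp_all add: xs_def)
  have "sorted_list_of_set (insert m S) = m # xs"
  proof -
    have "m \<notin> S" using assms(2) by blast
    then have "sorted_list_of_set (insert m S) = insort m xs"
      using assms(1) by (simp add: xs_def)
    also have "\<dots> = m # xs"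
      using assms(2) xs(3) by (intro insort_is_Cons) (auto intro: less_imp_le)
    finally show ?thesis .
  qed
  then have "pf M (insert m S) =
      (\<Sum>j<length xs. (-1) ^ j * M m (xs ! j) * pfaffian M (take j xs @ drop (Suc j) xs))"
    by (simp add: pf_def)
  also have "\<dots> = (\<Sum>j<length xs. pos_sign (xs ! j) S * M m (xs ! j) * pf M (S - {xs ! j}))"
  proof (rule sum.cong)
    fix j assume "j \<in> {..<length xs}"
    then have j: "j < length xs" by simp
    have split: "xs = take j xs @ xs ! j # drop (Suc j) xs"
      using id_take_nth_drop[OF j] .
    have "{s \<in> S. s < xs ! j} = (!) xs ` {..<j}"
    proof -
      have "s \<in> (!) xs ` {..<j}" if "s \<in> S" "s < xs ! j" for s
      proof -
        from that(1) xs(3) obtain i where i: "i < length xs" "s = xs ! i"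
          by (metis in_set_conv_nth)
        have "i < j"
          using i that(2) sorted_wrt_nth_less[OF xs(1), of j i] by (metis j linorder_neqE_nat less_asym)
        with i show ?thesis by auto
      qed
      moreover have "xs ! i \<in> S" "xs ! i < xs ! j" if "i < j" for i
        using that j xs(3) sorted_wrt_nth_less[OF xs(1), of i j] by auto
      ultimately show ?thesis by auto
    qed
    moreover have "inj_on ((!) xs) {..<j}"
      using xs(2) j by (auto intro: inj_on_nth)
    ultimately have sign: "pos_sign (xs ! j) S = (-1) ^ j"
      by (simp add: pos_sign_def card_image)
    have "sorted_list_of_set (S - {xs ! j}) = remove1 (xs ! j) xs"
      using assms(1) by (simp add: xs_def sorted_list_of_set_remove)
    also have "\<dots> = take j xs @ drop (Suc j) xs"
    proof -
      have "xs ! j \<notin> set (take j xs)"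
        using xs(2) split by (metis distinct_append disjoint_iff list.set_intros(1))
      then show ?thesis
        by (subst split) (simp add: remove1_append)
    qed
    finally show "(-1) ^ j * M m (xs ! j) * pfaffian M (take j xs @ drop (Suc j) xs) =
        pos_sign (xs ! j) S * M m (xs ! j) * pf M (S - {xs ! j})"
      by (simp add: pf_def sign)
  qed simp
  also have "\<dots> = (\<Sum>y\<in>S. pos_sign y S * M m y * pf M (S - {y}))"
    using xs by (intro sum.reindex_bij_betw) (auto intro: bij_betw_nth)
  finally show ?thesis .
qed

lemma sum_pairs_swap:
  fixes f :: "nat \<Rightarrow> nat \<Rightarrow> complex"
  assumes "finite R"
  shows "(\<Sum>z\<in>R. \<Sum>y\<in>R - {z}. f z y) = (\<Sum>y\<in>R. \<Sum>z\<in>R - {y}. f z y)"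
proof -
  have "R - {z} = {y \<in> R. y \<noteq> z}" for z by auto
  then show ?thesis
    using sum.swap_restrict[OF assms assms, of f "\<lambda>z y. y \<noteq> z"]
    by (simp add: eq_commute)
qed

text \<open>Induction on \<open>card S\<close>. Expanding along the minimum \<open>m\<close> and
  then along \<open>x\<close> gives the same double sum as expanding along \<open>x\<close> and then
  along \<open>m\<close>; only the order signs have to be matched.\<close>

lemma pf_insert:
  assumes "finite S" "x \<notin> S"
    and "\<And>i j. i \<in> insert x S \<Longrightarrow> j \<in> insert x S \<Longrightarrow> M i j = - M j i"
  shows "pf M (insert x S) = pos_sign x S * (\<Sum>y\<in>S. pos_sign y S * M x y * pf M (S - {y}))"
  using assms
proof (induction "card S" arbitrary: S rule: less_induct)
  case less
  show ?case
  proof (cases "\<forall>s\<in>S. x < s")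
    case True
    then have "{s \<in> S. s < x} = {}" by fastforce
    then have "pos_sign x S = 1" by (simp only: pos_sign_def card.empty power_0)
    then show ?thesis
      using pf_insert_least[OF less.prems(1), of x M] True by simp
  next
    case False
    define m where "m = Min S"
    define R where "R = S - {m}"
    from False have "S \<noteq> {}" by auto
    with less.prems(1) have mS: "m \<in> S" by (simp add: m_def)
    have m_le: "m \<le> s" if "s \<in> S" for s using that less.prems(1) by (simp add: m_def)
    have S: "S = insert m R" "m \<notin> R" using mS by (auto simp: R_def)
    have R: "finite R" "x \<notin> R" using less.prems(1,2) by (auto simp: R_def)
    have m_less: "m < s" if "s \<in> R" for s
      using m_le[of s] that by (auto simp: R_def)
    have "m < x"
      using False m_le less.prems(2) mS by (metis le_less_trans linorder_neqE_nat)
    have sign_x: "pos_sign x S = - pos_sign x R"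
      using \<open>m < x\<close> S R by (simp add: pos_sign_insert)
    have sign_R: "pos_sign y S = - pos_sign y R" if "y \<in> R" for y
      using m_less[OF that] S R by (simp add: pos_sign_insert)
    have sign_m: "pos_sign m S = 1"
    proof -
      have "{s \<in> S. s < m} = {}" using m_le by (auto simp: not_less)
      then show ?thesis by (simp only: pos_sign_def card.empty power_0)
    qed
    \<comment> \<open>The term pairing \<open>z\<close> with \<open>m\<close> and \<open>y\<close>
      with \<open>x\<close>. The factor \<open>ord_sign z y\<close> is due to \<open>z\<close>
      leaving \<open>R\<close> before \<open>y\<close>; the leading minus is the product
      \<open>ord_sign x z * ord_sign z x\<close>.\<close>
    define g where "g z y = - (pos_sign z R * pos_sign x R * pos_sign y R * ord_sign z y
      * M m z * M x y * pf M (R - {z} - {y}))" for z y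
    have "pf M (insert x S) = pf M (insert m (insert x R))"
      by (simp add: S insert_commute)
    also have "\<dots> = (\<Sum>z\<in>insert x R. pos_sign z (insert x R) * M m z * pf M (insert x R - {z}))"
      using R m_less \<open>m < x\<close> by (intro pf_insert_least) auto
    \<comment> \<open>The term pairing \<open>m\<close> with \<open>x\<close> is set apart; by skew
      symmetry it becomes the summand \<open>y = m\<close> of the expansion along
      \<open>x\<close>.\<close>
    also have "\<dots> = pos_sign x (insert x R) * M m x * pf M R
        + (\<Sum>z\<in>R. pos_sign z (insert x R) * M m z * pf M (insert x R - {z}))"
      using R by simp
    also have "pos_sign x (insert x R) = pos_sign x R"
      using R by (simp add: pos_sign_insert)
    also have "(\<Sum>z\<in>R. pos_sign z (insert x R) * M m z * pf M (insert x R - {z}))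
        = (\<Sum>z\<in>R. \<Sum>y\<in>R - {z}. g z y)"
    proof (rule sum.cong)
      fix z assume z: "z \<in> R"
      then have zx: "z \<noteq> x" using R by auto
      have eq: "insert x R - {z} = insert x (R - {z})" using zx by auto
      have "card (R - {z}) < card S"
        unfolding S(1) using S R by (simp add: card_Diff1_le le_imp_less_Suc)
      then have IH: "pf M (insert x (R - {z})) = pos_sign x (R - {z}) *
          (\<Sum>y\<in>R - {z}. pos_sign y (R - {z}) * M x y * pf M (R - {z} - {y}))"
        using R less.prems(3) S by (intro less.hyps) auto
      show "pos_sign z (insert x R) * M m z * pf M (insert x R - {z}) = (\<Sum>y\<in>R - {z}. g z y)"
        unfolding eq IH sum_distrib_left using R z zx
        by (intro sum.cong) (auto simp: g_def pos_sign_insert pos_sign_remove)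
    qed simp
    also have "\<dots> = (\<Sum>y\<in>R. \<Sum>z\<in>R - {y}. g z y)"
      by (rule sum_pairs_swap[OF R(1)])
    also have "\<dots> = (\<Sum>y\<in>R. pos_sign x R * (pos_sign y R * M x y * pf M (S - {y})))"
    proof (rule sum.cong)
      fix y assume y: "y \<in> R"
      then have eq: "S - {y} = insert m (R - {y})" using S by auto
      have "pf M (insert m (R - {y})) =
          (\<Sum>z\<in>R - {y}. pos_sign z (R - {y}) * M m z * pf M (R - {y} - {z}))"
        using R m_less by (intro pf_insert_least) auto
      then show "(\<Sum>z\<in>R - {y}. g z y) = pos_sign x R * (pos_sign y R * M x y * pf M (S - {y}))"
        unfolding eq
      proof (simp only: sum_distrib_left, intro sum.cong refl)
        fix z assume "z \<in> R - {y}"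
        moreover have "R - {z} - {y} = R - {y} - {z}" by auto
        \<comment> \<open>Reversing the order of removal changes the sign, which cancels the leading
          minus of \<open>g\<close>.\<close>
        moreover have "ord_sign z y = - ord_sign y z" if "z \<noteq> y" using that by auto
        ultimately show "g z y = pos_sign x R * (pos_sign y R * M x y *
            (pos_sign z (R - {y}) * M m z * pf M (R - {y} - {z})))"
          using R y by (simp add: g_def pos_sign_remove)
      qed
    qed simp
    also have "\<dots> = - pos_sign x R * (\<Sum>y\<in>R. pos_sign y S * M x y * pf M (S - {y}))"
      by (simp add: sign_R sum_distrib_left)
    also have "M m x = - M x m"
      using less.prems(3) mS by blast
    finally have "pf M (insert x S) = - pos_sign x R *
        (M x m * pf M R + (\<Sum>y\<in>R. pos_sign y S * M x y * pf M (S - {y})))"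
      by (simp add: algebra_simps)
    also have "\<dots> = pos_sign x S * (\<Sum>y\<in>S. pos_sign y S * M x y * pf M (S - {y}))"
      unfolding sign_x sum.remove[OF less.prems(1) mS] sign_m by (simp add: R_def)
    finally show ?thesis .
  qed
qed

text \<open>A Pfaffian with a repeated row vanishes.\<close>

lemma pf_repeated_row:
  assumes "finite S" "x \<in> S"
    and skew: "\<And>i j. i \<in> S \<Longrightarrow> j \<in> S \<Longrightarrow> M i j = - M j i"
  shows "(\<Sum>y\<in>S. pos_sign y S * M x y * pf M (S - {y})) = 0"
proof -
  define R where "R = S - {x}"
  have S: "S = insert x R" and R: "finite R" "x \<notin> R" using assms(1,2) by (auto simp: R_def)
  \<comment> \<open>Each minor is expanded along \<open>x\<close> again. The result is antisymmetric
    in \<open>y\<close> and \<open>z\<close>, so the sum over ordered pairs equals its own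
    negative.\<close>
  define g where "g y z = - (pos_sign x R * pos_sign y R * pos_sign z R * ord_sign y z
    * M x y * M x z * pf M (R - {y} - {z}))" for y z
  have "M x x = 0" using skew[OF assms(2) assms(2)] by simp
  then have "(\<Sum>y\<in>S. pos_sign y S * M x y * pf M (S - {y}))
      = (\<Sum>y\<in>R. pos_sign y S * M x y * pf M (S - {y}))"
    using R by (simp add: S)
  also have "\<dots> = (\<Sum>y\<in>R. \<Sum>z\<in>R - {y}. g y z)"
  proof (rule sum.cong)
    fix y assume y: "y \<in> R"
    then have yx: "y \<noteq> x" using R by auto
    have eq: "S - {y} = insert x (R - {y})" using S yx by auto
    have "pf M (insert x (R - {y})) = pos_sign x (R - {y}) *
        (\<Sum>z\<in>R - {y}. pos_sign z (R - {y}) * M x z * pf M (R - {y} - {z}))"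
      using R by (intro pf_insert skew) (auto simp: S)
    then show "pos_sign y S * M x y * pf M (S - {y}) = (\<Sum>z\<in>R - {y}. g y z)"
      unfolding eq using R y yx
      by (auto intro!: sum.cong simp: S sum_distrib_left g_def pos_sign_remove pos_sign_insert)
  qed simp
  finally have 1: "(\<Sum>y\<in>S. pos_sign y S * M x y * pf M (S - {y})) = (\<Sum>y\<in>R. \<Sum>z\<in>R - {y}. g y z)" .
  have "(\<Sum>y\<in>R. \<Sum>z\<in>R - {y}. g y z) = (\<Sum>z\<in>R. \<Sum>y\<in>R - {z}. g y z)"
    by (rule sum_pairs_swap[OF R(1)])
  also have "\<dots> = - (\<Sum>z\<in>R. \<Sum>y\<in>R - {z}. g z y)"
    unfolding sum_negf[symmetric]
    by (intro sum.cong) (auto simp: g_def Diff_insert[symmetric] insert_commute)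
  finally show ?thesis using 1 by simp
qed

text \<open>Both halves of the sum are, up to sign, the same double sum of
  \<open>M x y * pf M (X - {x}) * pf M (Y - {y})\<close> over \<open>x\<close> in \<open>X\<close> and \<open>y\<close> in \<open>Y\<close>.\<close>

lemma pf_pluecker:
  assumes fin: "finite X" "finite Y"
    and skew: "\<And>i j. i \<in> X \<union> Y \<Longrightarrow> j \<in> X \<union> Y \<Longrightarrow> M i j = - M j i"
  shows "(\<Sum>x\<in>sym_diff X Y. pos_sign x (sym_diff X Y)
    * (pf M (sym_diff X {x}) * pf M (sym_diff Y {x}))) = 0"
proof -
  define h where "h X Y x = pos_sign x (sym_diff X Y)
    * (pf M (sym_diff X {x}) * pf M (sym_diff Y {x}))" for X Y x
  define d where "d X Y x y = pos_sign x X * pos_sign y Y * M x y * pf M (X - {x}) * pf M (Y - {y})"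
    for X Y x y
  have half: "(\<Sum>x\<in>X - Y. h X Y x) = (\<Sum>x\<in>X. \<Sum>y\<in>Y. d X Y x y)"
    if fin: "finite X" "finite Y"
      and skew: "\<And>i j. i \<in> X \<union> Y \<Longrightarrow> j \<in> X \<union> Y \<Longrightarrow> M i j = - M j i" for X Y
  proof -
    have inner: "(\<Sum>y\<in>Y. d X Y x y) =
        pos_sign x X * pf M (X - {x}) * (\<Sum>y\<in>Y. pos_sign y Y * M x y * pf M (Y - {y}))" for x
      by (simp add: d_def sum_distrib_left mult_ac)
    have "(\<Sum>x\<in>X - Y. h X Y x) = (\<Sum>x\<in>X - Y. \<Sum>y\<in>Y. d X Y x y)"
    proof (rule sum.cong)
      fix x assume x: "x \<in> X - Y"
      then have eq: "sym_diff X {x} = X - {x}" "sym_diff Y {x} = insert x Y" by auto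
      have "pf M (insert x Y) = pos_sign x Y * (\<Sum>y\<in>Y. pos_sign y Y * M x y * pf M (Y - {y}))"
        using x by (intro pf_insert fin skew) auto
      then show "h X Y x = (\<Sum>y\<in>Y. d X Y x y)"
        using pos_sign_square[of x Y]
        by (simp add: h_def eq inner pos_sign_sym_diff fin)
    qed simp
    \<comment> \<open>The indices added here lie in both sets, where the inner sum expands a
      Pfaffian with a repeated row.\<close>
    also have "\<dots> = (\<Sum>x\<in>X. \<Sum>y\<in>Y. d X Y x y)"
    proof (rule sum.mono_neutral_left)
      show "\<forall>x\<in>X - (X - Y). (\<Sum>y\<in>Y. d X Y x y) = 0"
      proof
        fix x assume "x \<in> X - (X - Y)"
        then have "x \<in> Y" by simp
        then have "(\<Sum>y\<in>Y. pos_sign y Y * M x y * pf M (Y - {y})) = 0"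
          by (intro pf_repeated_row fin skew) auto
        then show "(\<Sum>y\<in>Y. d X Y x y) = 0"
          by (simp add: inner)
      qed
    qed (use fin in auto)
    finally show ?thesis .
  qed
  have "(\<Sum>x\<in>sym_diff X Y. h X Y x) = (\<Sum>x\<in>X - Y. h X Y x) + (\<Sum>x\<in>Y - X. h X Y x)"
    using fin by (intro sum.union_disjoint) auto
  also have "(\<Sum>x\<in>Y - X. h X Y x) = (\<Sum>x\<in>Y - X. h Y X x)"
    by (simp add: h_def Un_commute mult.commute)
  also have "\<dots> = (\<Sum>y\<in>Y. \<Sum>x\<in>X. d Y X y x)"
    by (intro half fin skew) auto
  also have "\<dots> = (\<Sum>x\<in>X. \<Sum>y\<in>Y. d Y X y x)"
    by (rule sum.swap)
  also have "\<dots> = - (\<Sum>x\<in>X. \<Sum>y\<in>Y. d X Y x y)"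
    unfolding sum_negf[symmetric]
  proof (intro sum.cong refl)
    fix x y assume "x \<in> X" "y \<in> Y"
    then have "M y x = - M x y" by (intro skew) auto
    then show "d Y X y x = - d X Y x y" by (simp add: d_def)
  qed
  also have "(\<Sum>x\<in>X - Y. h X Y x) = (\<Sum>x\<in>X. \<Sum>y\<in>Y. d X Y x y)"
    by (intro half fin skew) auto
  finally show ?thesis by (simp add: h_def)
qed

section \<open>Four-term relations on the cone\<close>

lemma sPf_dual_apply:
  assumes "J \<subseteq> {1..n}"
  shows "sPf_dual n M J = pf M ({1..n} - J)"
proof -
  have "bra ({1..n} - I) J = of_bool (I = {1..n} - J)" if "I \<in> Pow {1..n}" for I
    using assms that by (auto simp: bra_def)
  then have "sPf_dual n M J = (\<Sum>I\<in>Pow {1..n}. if I = {1..n} - J then pf M I else 0)"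
    unfolding sPf_dual_def pf_def by (intro sum.cong) auto
  then show ?thesis
    by (simp add: sum.delta)
qed

lemma sPf_dual_outside:
  assumes "\<not> J \<subseteq> {1..n}"
  shows "sPf_dual n M J = 0"
  unfolding sPf_dual_def using assms by (intro sum.neutral) (auto simp: bra_def)

lemma hom_poly_fun_zero: "hom_poly_fun n d (\<lambda>t. 0)"
proof (induction d)
  case 0
  then show ?case by (rule hom_poly_fun.const)
next
  case (Suc d)
  from hom_poly_fun.mult[OF this hom_poly_fun.coord[of "{}"]] show ?case by simp
qed

lemma hom_poly_fun_sum:
  "(\<And>x. x \<in> S \<Longrightarrow> hom_poly_fun n d (f x)) \<Longrightarrow> hom_poly_fun n d (\<lambda>t. \<Sum>x\<in>S. f x t)"
  by (induction S rule: infinite_finite_induct)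
    (simp_all add: hom_poly_fun_zero hom_poly_fun.add)

lemma hom_poly_fun_scale:
  "hom_poly_fun n d f \<Longrightarrow> f (\<lambda>I. c * t I) = c ^ d * f t"
  by (induction rule: hom_poly_fun.induct) (simp_all add: distrib_left power_add)

text \<open>Homogeneous relations survive scaling, and the coefficient at the full set is
  \<open>c\<close> times the Pfaffian of the empty matrix, hence nonzero. Emptiness for punctured
  lines thus reduces to emptiness for the cone without zero.\<close>

lemma pfaffian_punctured_lines_subset:
  "pfaffian_punctured_lines n \<subseteq> pfaffian_cone n - {\<lambda>I. 0}"
proof
  fix q assume "q \<in> pfaffian_punctured_lines n"
  then obtain c M where c: "c \<noteq> 0" and M: "skew_symmetric n M"
    and q: "q = (\<lambda>I. c * sPf_dual n M I)"
    by (auto simp: pfaffian_punctured_lines_def pfaffian_cogates_def)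
  have "sPf_dual n M {1..n} = 1"
    by (simp add: sPf_dual_apply pf_def)
  then have "q \<noteq> (\<lambda>I. 0)"
    using c q by (metis mult_eq_0_iff one_neq_zero)
  moreover have "q \<in> pfaffian_cone n"
    using M by (auto simp: pfaffian_cone_def tensor_space_def q sPf_dual_outside
        hom_poly_fun_scale pfaffian_cogates_def)
  ultimately show "q \<in> pfaffian_cone n - {\<lambda>I. 0}" by simp
qed

text \<open>The relation is homogeneous of degree 2, so it only has to be checked on Pfaffian
  cogates. Their coordinates are Pfaffians of complements, and complementing both sets preserves
  their symmetric difference, so \<open>pf_pluecker\<close> applies.\<close>

lemma pfaffian_cone_pluecker:
  assumes t: "t \<in> pfaffian_cone n" and X: "X \<subseteq> {1..n}" and Y: "Y \<subseteq> {1..n}"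
  shows "(\<Sum>x\<in>sym_diff X Y. pos_sign x (sym_diff X Y) * (t (sym_diff X {x}) * t (sym_diff Y {x}))) = 0"
proof -
  define f :: "tensor \<Rightarrow> complex" where
    "f t = (\<Sum>x\<in>sym_diff X Y. pos_sign x (sym_diff X Y) * (t (sym_diff X {x}) * t (sym_diff Y {x})))" for t
  have "hom_poly_fun n (0 + (1 + 1)) f"
    unfolding f_def using X Y
    by (intro hom_poly_fun_sum hom_poly_fun.mult hom_poly_fun.const hom_poly_fun.coord) auto
  moreover have "f p = 0" if "p \<in> pfaffian_cogates n" for p
  proof -
    from that obtain M where M: "skew_symmetric n M" and p: "p = sPf_dual n M"
      by (auto simp: pfaffian_cogates_def)
    define X' Y' where "X' = {1..n} - X" and "Y' = {1..n} - Y"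
    have sd: "sym_diff X Y = sym_diff X' Y'" using X Y by (auto simp: X'_def Y'_def)
    have "p (sym_diff X {x}) = pf M (sym_diff X' {x})" "p (sym_diff Y {x}) = pf M (sym_diff Y' {x})"
      if "x \<in> sym_diff X Y" for x
    proof -
      from that X Y have x: "x \<in> {1..n}" by auto
      have eq: "{1..n} - sym_diff X {x} = sym_diff X' {x}" "{1..n} - sym_diff Y {x} = sym_diff Y' {x}"
        using x X Y by (auto simp: X'_def Y'_def)
      show "p (sym_diff X {x}) = pf M (sym_diff X' {x})"
        unfolding p eq[symmetric] by (rule sPf_dual_apply) (use x X in auto)
      show "p (sym_diff Y {x}) = pf M (sym_diff Y' {x})"
        unfolding p eq[symmetric] by (rule sPf_dual_apply) (use x Y in auto)
    qed
    then have "f p = (\<Sum>x\<in>sym_diff X' Y'. pos_sign x (sym_diff X' Y')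
        * (pf M (sym_diff X' {x}) * pf M (sym_diff Y' {x})))"
      unfolding f_def sd[symmetric] by (intro sum.cong refl) simp
    also have "\<dots> = 0"
    proof (rule pf_pluecker)
      show "M i j = - M j i" if "i \<in> X' \<union> Y'" "j \<in> X' \<union> Y'" for i j
        using M that unfolding skew_symmetric_def X'_def Y'_def by blast
    qed (auto simp: X'_def Y'_def)
    finally show ?thesis .
  qed
  ultimately have "f t = 0"
    using t by (auto simp: pfaffian_cone_def)
  then show ?thesis by (simp add: f_def)
qed

lemma pfaffian_cone_four:
  assumes t: "t \<in> pfaffian_cone n" and u: "a < b" "b < c" "c < d"
    and sub: "{a, b, c, d} \<subseteq> {1..n}" and X: "X \<subseteq> {1..n}"
  shows "t (sym_diff X {a}) * t (sym_diff X {b, c, d}) - t (sym_diff X {b}) * t (sym_diff X {a, c, d})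
    + t (sym_diff X {c}) * t (sym_diff X {a, b, d}) - t (sym_diff X {d}) * t (sym_diff X {a, b, c}) = 0"
proof -
  \<comment> \<open>Chosen so that the symmetric difference with \<open>X\<close> is exactly
    \<open>{a, b, c, d}\<close>, whose signs alternate in increasing order.\<close>
  define Y where "Y = sym_diff X {a, b, c, d}"
  have Y: "Y \<subseteq> {1..n}" using X sub by (auto simp: Y_def)
  have sd: "sym_diff X Y = {a, b, c, d}" by (auto simp: Y_def)
  have eq: "sym_diff Y {a} = sym_diff X {b, c, d}" "sym_diff Y {b} = sym_diff X {a, c, d}"
    "sym_diff Y {c} = sym_diff X {a, b, d}" "sym_diff Y {d} = sym_diff X {a, b, c}"
    using u by (auto simp: Y_def)
  have "pos_sign a {a, b, c, d} = 1" "pos_sign b {a, b, c, d} = -1"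
    "pos_sign c {a, b, c, d} = 1" "pos_sign d {a, b, c, d} = -1"
    using u by (simp_all add: pos_sign_insert)
  then show ?thesis
    using pfaffian_cone_pluecker[OF t X Y] u unfolding sd by (simp add: eq algebra_simps)
qed

text \<open>The pairs \<open>(a, c)\<close> and \<open>(b, d)\<close> cross; for two pairs that do not cross, the four-term relation is
  satisfied by every product.\<close>

lemma pfaffian_cone_crossing:
  fixes f g :: "bool \<Rightarrow> bool \<Rightarrow> complex"
  assumes t: "t \<in> pfaffian_cone n" and u: "a < b" "b < c" "c < d"
    and sub: "{a, b, c, d} \<subseteq> {1..n}"
    and Z: "Z \<subseteq> {1..n}" "Z \<inter> {a, b, c, d} = {}"
    and T: "\<And>I. I \<subseteq> {1..n} \<Longrightarrow> even (card I) \<Longrightarrow> I - {a, b, c, d} = Z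
      \<Longrightarrow> t I = f (a \<in> I) (c \<in> I) * g (b \<in> I) (d \<in> I)"
  shows "even (card Z) \<Longrightarrow>
      f True True * f False False * (g True True * g False False) =
      f True False * f False True * (g True False * g False True)"
    and "odd (card Z) \<Longrightarrow>
      f True False * f False True * (g True True * g False False) =
      f True True * f False False * (g True False * g False True)"
proof -
  have fin: "finite Z" using Z(1) by (rule finite_subset) simp
  have val: "t (Z \<union> U) = f (a \<in> U) (c \<in> U) * g (b \<in> U) (d \<in> U)"
    if "U \<subseteq> {a, b, c, d}" "even (card Z + card U)" for U
  proof -
    have "finite U" using that(1) by (rule finite_subset) simp
    then have "card (Z \<union> U) = card Z + card U"
      using Z that(1) by (intro card_Un_disjoint fin) auto
    then have "t (Z \<union> U) = f (a \<in> Z \<union> U) (c \<in> Z \<union> U) * g (b \<in> Z \<union> U) (d \<in> Z \<union> U)"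
      using that sub Z by (intro T) auto
    moreover have "a \<notin> Z" "b \<notin> Z" "c \<notin> Z" "d \<notin> Z" using Z by auto
    ultimately show ?thesis by simp
  qed
  have four: "t (sym_diff (Z \<union> V) {a}) * t (sym_diff (Z \<union> V) {b, c, d})
      - t (sym_diff (Z \<union> V) {b}) * t (sym_diff (Z \<union> V) {a, c, d})
      + t (sym_diff (Z \<union> V) {c}) * t (sym_diff (Z \<union> V) {a, b, d})
      - t (sym_diff (Z \<union> V) {d}) * t (sym_diff (Z \<union> V) {a, b, c}) = 0"
    if "V \<subseteq> {a, b, c, d}" for V
    using that Z sub by (intro pfaffian_cone_four[OF t u]) auto
  have shift: "sym_diff (Z \<union> V) U = Z \<union> sym_diff V U"
    if "V \<subseteq> {a, b, c, d}" "U \<subseteq> {a, b, c, d}" for U V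
    using that Z by auto
  \<comment> \<open>The base set \<open>Z \<union> {a}\<close> (and \<open>Z\<close> itself in the
    odd case) makes all eight sets even, so the product formula applies. The first and third
    products agree, and so do the second and fourth: the relation is twice the claimed
    equation.\<close>
  show "f True True * f False False * (g True True * g False False) =
      f True False * f False True * (g True False * g False True)" if "even (card Z)"
  proof -
    have sd: "sym_diff {a} {a} = {}" "sym_diff {a} {b, c, d} = {a, b, c, d}"
      "sym_diff {a} {b} = {a, b}" "sym_diff {a} {a, c, d} = {c, d}"
      "sym_diff {a} {c} = {a, c}" "sym_diff {a} {a, b, d} = {b, d}"
      "sym_diff {a} {d} = {a, d}" "sym_diff {a} {a, b, c} = {b, c}"
      using u by auto
    have "t (Z \<union> {}) * t (Z \<union> {a, b, c, d}) - t (Z \<union> {a, b}) * t (Z \<union> {c, d})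
      + t (Z \<union> {a, c}) * t (Z \<union> {b, d}) - t (Z \<union> {a, d}) * t (Z \<union> {b, c}) = 0"
      using four[of "{a}"]
      by (simp only: shift sd insert_subset empty_subsetI insert_iff simp_thms)
    then show ?thesis
      using u that by (subst (asm) (1 2 3 4 5 6 7 8) val) (auto simp: algebra_simps)
  qed
  show "f True False * f False True * (g True True * g False False) =
      f True True * f False False * (g True False * g False True)" if "odd (card Z)"
  proof -
    have "t (Z \<union> {a}) * t (Z \<union> {b, c, d}) - t (Z \<union> {b}) * t (Z \<union> {a, c, d})
      + t (Z \<union> {c}) * t (Z \<union> {a, b, d}) - t (Z \<union> {d}) * t (Z \<union> {a, b, c}) = 0"
      using four[of "{}"] Z by (simp add: shift del: Un_insert_right)
    then show ?thesis
      using u that by (subst (asm) (1 2 3 4 5 6 7 8) val) (auto simp: algebra_simps)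
  qed
qed

section \<open>Products of bilinear forms\<close>

text \<open>The \<open>2 * k\<close> pairs of positions matched by \<open>k\<close> copies of SWAP: the pairs \<open>2 * b\<close> and \<open>2 * b + 1\<close>
  are \<open>(4 * b + 1, 4 * b + 3)\<close> and \<open>(4 * b + 2, 4 * b + 4)\<close>.\<close>

definition lpos :: "nat \<Rightarrow> nat" where
  "lpos s = 4 * (s div 2) + s mod 2 + 1"

definition rpos :: "nat \<Rightarrow> nat" where
  "rpos s = lpos s + 2"

lemma lpos_cases:
  obtains (even) q where "s = 2 * q" "lpos s = 4 * q + 1"
  | (odd) q where "s = 2 * q + 1" "lpos s = 4 * q + 2"
proof (cases "even s")
  case True
  then show ?thesis by (intro even[of "s div 2"]) (auto simp: lpos_def elim: evenE)
next
  case False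
  then show ?thesis by (intro odd[of "s div 2"]) (auto simp: lpos_def elim: oddE)
qed

lemma lpos_eq_iff [simp]: "lpos s = lpos t \<longleftrightarrow> s = t"
  by (cases s rule: lpos_cases; cases t rule: lpos_cases) (simp; presburger)+

lemma rpos_eq_iff [simp]: "rpos s = rpos t \<longleftrightarrow> s = t"
  by (simp add: rpos_def)

lemma lpos_neq_rpos [simp]: "lpos s \<noteq> rpos t" "rpos t \<noteq> lpos s"
  unfolding rpos_def by (cases s rule: lpos_cases; cases t rule: lpos_cases; simp; presburger)+

lemma Suc_0_le_pos [simp]: "Suc 0 \<le> lpos s" "Suc 0 \<le> rpos s"
  by (simp_all add: lpos_def rpos_def)

lemma pos_le [simp]: "s < 2 * k \<Longrightarrow> lpos s \<le> 4 * k" "s < 2 * k \<Longrightarrow> rpos s \<le> 4 * k"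
  unfolding rpos_def by (cases s rule: lpos_cases; auto)+

lemma positions_eq: "{1..4 * k} = lpos ` {..<2 * k} \<union> rpos ` {..<2 * k}"
proof
  show "{1..4 * k} \<subseteq> lpos ` {..<2 * k} \<union> rpos ` {..<2 * k}"
  proof
    fix i assume i: "i \<in> {1..4 * k}"
    define q r where "q = (i - 1) div 4" and "r = (i - 1) mod 4"
    have qr: "i = 4 * q + r + 1" "r < 4" "q < k"
      using i by (auto simp: q_def r_def less_mult_imp_div_less)
    consider "r < 2" | r' where "r = r' + 2" "r' < 2"
      using qr(2) by (cases "r < 2") (auto dest!: le_Suc_ex simp: not_less)
    then show "i \<in> lpos ` {..<2 * k} \<union> rpos ` {..<2 * k}"
    proof cases
      case 1
      then have "i = lpos (2 * q + r)" "2 * q + r < 2 * k" using qr by (auto simp: lpos_def)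
      then show ?thesis by blast
    next
      case 2
      then have "i = rpos (2 * q + r')" "2 * q + r' < 2 * k" using qr by (auto simp: rpos_def lpos_def)
      then show ?thesis by blast
    qed
  qed
  show "lpos ` {..<2 * k} \<union> rpos ` {..<2 * k} \<subseteq> {1..4 * k}"
    by auto
qed

lemma prod_positions:
  fixes h :: "nat \<Rightarrow> complex"
  shows "(\<Prod>i\<in>{1..4 * k}. h i) = (\<Prod>s<2 * k. h (lpos s) * h (rpos s))"
proof -
  have "(\<Prod>i\<in>{1..4 * k}. h i) = (\<Prod>i\<in>lpos ` {..<2 * k}. h i) * (\<Prod>i\<in>rpos ` {..<2 * k}. h i)"
    unfolding positions_eq by (intro prod.union_disjoint) auto
  then show ?thesis
    by (simp add: prod.reindex inj_on_def prod.distrib)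
qed

lemma sum_Pow_insert:
  fixes F :: "'a set \<Rightarrow> 'b::comm_monoid_add"
  assumes "finite A" "a \<notin> A"
  shows "(\<Sum>J\<in>Pow (insert a A). F J) = (\<Sum>J\<in>Pow A. F J + F (insert a J))"
proof -
  have "inj_on (insert a) (Pow A)"
    using assms(2) by (auto simp: inj_on_def)
  then have "(\<Sum>J\<in>insert a ` Pow A. F J) = (\<Sum>J\<in>Pow A. F (insert a J))"
    by (simp add: sum.reindex)
  moreover have "(\<Sum>J\<in>Pow (insert a A). F J) = (\<Sum>J\<in>Pow A. F J) + (\<Sum>J\<in>insert a ` Pow A. F J)"
    unfolding Pow_insert using assms by (intro sum.union_disjoint) auto
  ultimately show ?thesis by (simp add: sum.distrib)
qed

text \<open>A subset of the positions is an independent choice of two bits for each pair, so the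
  distributive law applies.\<close>

lemma sum_Pow_pairs:
  fixes f :: "nat \<Rightarrow> bool \<Rightarrow> bool \<Rightarrow> complex"
  assumes "finite Q"
  shows "(\<Sum>J\<in>Pow (lpos ` Q \<union> rpos ` Q). \<Prod>s\<in>Q. f s (lpos s \<in> J) (rpos s \<in> J))
    = (\<Prod>s\<in>Q. \<Sum>x\<in>UNIV. \<Sum>y\<in>UNIV. f s x y)"
  using assms
proof (induction Q)
  case empty
  then show ?case by simp
next
  case (insert q Q)
  define A where "A = lpos ` Q \<union> rpos ` Q"
  have A: "finite A" "lpos q \<notin> A" "rpos q \<notin> A" "lpos q \<notin> insert (rpos q) A"
    using insert by (auto simp: A_def)
  have eq: "lpos ` insert q Q \<union> rpos ` insert q Q = insert (lpos q) (insert (rpos q) A)"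
    by (auto simp: A_def)
  define P where "P J = (\<Prod>s\<in>Q. f s (lpos s \<in> J) (rpos s \<in> J))" for J
  have P: "P (insert (lpos q) J) = P J" "P (insert (rpos q) J) = P J" for J
  proof -
    have "s \<noteq> q" if "s \<in> Q" for s using that insert.hyps by auto
    then show "P (insert (lpos q) J) = P J" "P (insert (rpos q) J) = P J"
      unfolding P_def by (simp_all cong: prod.cong)
  qed
  have "(\<Sum>J\<in>Pow (lpos ` insert q Q \<union> rpos ` insert q Q).
      \<Prod>s\<in>insert q Q. f s (lpos s \<in> J) (rpos s \<in> J))
    = (\<Sum>J\<in>Pow (insert (lpos q) (insert (rpos q) A)). f q (lpos q \<in> J) (rpos q \<in> J) * P J)"
    unfolding eq P_def using insert by simp
  also have "\<dots> = (\<Sum>J\<in>Pow A. (\<Sum>x\<in>UNIV. \<Sum>y\<in>UNIV. f q x y) * P J)"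
  proof -
    have "lpos q \<notin> J" "rpos q \<notin> J" if "J \<in> Pow A" for J
      using that A by auto
    then show ?thesis
      using A by (auto simp: sum_Pow_insert P UNIV_bool distrib_right intro!: sum.cong)
  qed
  also have "\<dots> = (\<Prod>s\<in>insert q Q. \<Sum>x\<in>UNIV. \<Sum>y\<in>UNIV. f s x y)"
    using insert by (simp add: P_def A_def flip: sum_distrib_left)
  finally show ?case .
qed

section \<open>Obstructions to the four-term relations for products of forms\<close>

definition pair_product :: "nat \<Rightarrow> complex \<Rightarrow> (nat \<Rightarrow> bool \<Rightarrow> bool \<Rightarrow> complex) \<Rightarrow> tensor" where
  "pair_product k c A I = c * (\<Prod>s<2 * k. A s (lpos s \<in> I) (rpos s \<in> I))"

definition form_det :: "(bool \<Rightarrow> bool \<Rightarrow> complex) \<Rightarrow> complex" where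
  "form_det B = B True True * B False False - B True False * B False True"

text \<open>Diagonal or antidiagonal as a 2 by 2 matrix; the negation is the notion of a mixed
  form.\<close>

definition single_parity :: "(bool \<Rightarrow> bool \<Rightarrow> complex) \<Rightarrow> bool" where
  "single_parity B \<longleftrightarrow> (B True True = 0 \<and> B False False = 0) \<or> (B True False = 0 \<and> B False True = 0)"

lemma pair_product_split:
  assumes "Q \<subseteq> {..<2 * k}"
    and "\<And>s. s < 2 * k \<Longrightarrow> s \<notin> Q \<Longrightarrow> (lpos s \<in> I \<longleftrightarrow> lpos s \<in> Z) \<and> (rpos s \<in> I \<longleftrightarrow> rpos s \<in> Z)"
  shows "pair_product k c A I = (\<Prod>s\<in>Q. A s (lpos s \<in> I) (rpos s \<in> I))
    * (c * (\<Prod>s\<in>{..<2 * k} - Q. A s (lpos s \<in> Z) (rpos s \<in> Z)))"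
proof -
  have "(\<Prod>s\<in>{..<2 * k} - Q. A s (lpos s \<in> Z) (rpos s \<in> Z))
      = (\<Prod>s\<in>{..<2 * k} - Q. A s (lpos s \<in> I) (rpos s \<in> I))"
    using assms(2) by (intro prod.cong) auto
  then show ?thesis
    unfolding pair_product_def by (simp add: prod.subset_diff[OF assms(1)])
qed

text \<open>An invertible diagonal or antidiagonal form has exactly one nonzero product of opposite
  entries. A nonzero \<open>t I\<close> fixes the types of both forms, and the parity of the
  remaining set then selects the crossing relation in which exactly one side is zero.\<close>

lemma single_parity_block:
  assumes t: "t \<in> pfaffian_cone (4 * k)" and j: "j < k"
    and T: "\<And>I. I \<subseteq> {1..4 * k} \<Longrightarrow> even (card I) \<Longrightarrow> t I = pair_product k c A I"
    and det: "form_det (A (2 * j)) \<noteq> 0" "form_det (A (2 * j + 1)) \<noteq> 0"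
    and single_parity: "single_parity (A (2 * j))" "single_parity (A (2 * j + 1))"
    and I: "I \<subseteq> {1..4 * k}" "even (card I)"
  shows "t I = 0"
proof (rule ccontr)
  assume nz: "t I \<noteq> 0"
  define p q where "p = 2 * j" and "q = 2 * j + 1"
  have pq: "p < 2 * k" "q < 2 * k" "p \<noteq> q" using j by (auto simp: p_def q_def)
  have ord: "lpos p < lpos q" "lpos q < rpos p" "rpos p < rpos q"
    by (simp_all add: p_def q_def lpos_def rpos_def)
  define D where "D = {lpos p, lpos q, rpos p, rpos q}"
  define Z where "Z = I - D"
  define C where "C = c * (\<Prod>s\<in>{..<2 * k} - {p, q}. A s (lpos s \<in> Z) (rpos s \<in> Z))"
  have DI: "D \<subseteq> {1..4 * k}" using pq by (auto simp: D_def)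
  have prod: "t J = A p (lpos p \<in> J) (rpos p \<in> J) * (C * A q (lpos q \<in> J) (rpos q \<in> J))"
    if "J \<subseteq> {1..4 * k}" "even (card J)" "J - D = Z" for J
  proof -
    have "x \<in> J \<longleftrightarrow> x \<in> Z" if "x \<notin> D" for x
      using that \<open>J - D = Z\<close> by blast
    then have "pair_product k c A J = (\<Prod>s\<in>{p, q}. A s (lpos s \<in> J) (rpos s \<in> J)) * C"
      unfolding C_def using pq by (intro pair_product_split) (auto simp: D_def)
    then show ?thesis using T[OF that(1,2)] pq by simp
  qed
  have cross: "even (card Z) \<Longrightarrow>
      A p True True * A p False False * (C * A q True True * (C * A q False False)) =
      A p True False * A p False True * (C * A q True False * (C * A q False True))"
    "odd (card Z) \<Longrightarrow>
      A p True False * A p False True * (C * A q True True * (C * A q False False)) =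
      A p True True * A p False False * (C * A q True False * (C * A q False True))"
    using pfaffian_cone_crossing[OF t ord, of Z "A p" "\<lambda>x y. C * A q x y"]
      prod DI I unfolding D_def by (auto simp: Z_def D_def)
  have "finite I" using I(1) by (rule finite_subset) simp
  then have "card I = card Z + card (I \<inter> D)"
    using card_Int_Diff[of I D] by (simp add: Z_def)
  then have parity: "even (card Z) \<longleftrightarrow> even (card (I \<inter> D))" using I(2) by presburger
  have "I \<inter> D = (if lpos p \<in> I then {lpos p} else {}) \<union> (if lpos q \<in> I then {lpos q} else {})
      \<union> (if rpos p \<in> I then {rpos p} else {}) \<union> (if rpos q \<in> I then {rpos q} else {})"
    by (auto simp: D_def)
  \<comment> \<open>With \<open>parity\<close>: \<open>Z\<close> has even size exactly when the
    entries of the two forms selected by \<open>I\<close> are both diagonal or both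
    off-diagonal.\<close>
  then have par: "even (card (I \<inter> D)) \<longleftrightarrow>
      ((lpos p \<in> I) = (rpos p \<in> I)) = ((lpos q \<in> I) = (rpos q \<in> I))"
    using ord pq(3) by simp
  have nz': "A p (lpos p \<in> I) (rpos p \<in> I) \<noteq> 0" "A q (lpos q \<in> I) (rpos q \<in> I) \<noteq> 0" "C \<noteq> 0"
    using nz prod[OF I] by (auto simp: Z_def)
  have "form_det (A p) \<noteq> 0" "form_det (A q) \<noteq> 0" "single_parity (A p)" "single_parity (A q)"
    using det single_parity by (simp_all add: p_def q_def)
  then show False
    using nz' cross parity par
    by (cases "lpos p \<in> I"; cases "rpos p \<in> I"; cases "lpos q \<in> I"; cases "rpos q \<in> I")
      (auto simp: single_parity_def form_det_def)
qed

text \<open>At most one entry is zero: invertibility makes both entries on one diagonal nonzero, and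
  being mixed gives a nonzero entry on the other. Some row and some column avoid the zero.\<close>

lemma not_single_parity_line:
  assumes "form_det B \<noteq> 0" "\<not> single_parity B"
  shows "\<exists>y. B False y \<noteq> 0 \<and> B True y \<noteq> 0" "\<exists>x. B x False \<noteq> 0 \<and> B x True \<noteq> 0"
  using assms unfolding form_det_def single_parity_def by (metis mult_eq_0_iff diff_zero)+

text \<open>The pair \<open>p\<close> crosses the positions \<open>u\<close> and
  \<open>lpos r\<close>, which belong to different forms. With their partners fixed, the dependence
  on these two bits is a product of two one-bit functions. Such a form has determinant zero, so the
  relation says that \<open>form_det (A p)\<close> times a nonzero number vanishes.\<close>

lemma mixed_crossing:
  assumes t: "t \<in> pfaffian_cone (4 * k)"
    and T: "\<And>I. I \<subseteq> {1..4 * k} \<Longrightarrow> even (card I) \<Longrightarrow> t I = pair_product k c A I"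
    and c: "c \<noteq> 0" and det: "\<And>s. s < 2 * k \<Longrightarrow> form_det (A s) \<noteq> 0"
    and pqr: "p < 2 * k" "q < 2 * k" "r < 2 * k" "p \<noteq> q" "p \<noteq> r" "q \<noteq> r"
    and mixed: "\<not> single_parity (A q)" "\<not> single_parity (A r)"
    and u: "u = lpos q \<or> u = rpos q"
    and ord: "lpos p < u" "u < rpos p" "rpos p < lpos r"
  shows False
proof -
  \<comment> \<open>A bit for the partner of \<open>v\<close> that keeps the form nonzero for both
    bits at \<open>v\<close>. The negated conjuncts put bit 0 at \<open>v\<close> itself, so that
    \<open>Z\<close> will be disjoint from \<open>D\<close>.\<close>
  have line: "\<exists>x y. \<not> (v = lpos s \<and> x) \<and> \<not> (v = rpos s \<and> y) \<and>
      (\<forall>b. A s (x \<or> v = lpos s \<and> b) (y \<or> v = rpos s \<and> b) \<noteq> 0)"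
    if "s < 2 * k" "\<not> single_parity (A s)" "v = lpos s \<or> v = rpos s" for s v
  proof -
    from not_single_parity_line[OF det[OF that(1)] that(2)] obtain x y where
      "A s False y \<noteq> 0" "A s True y \<noteq> 0" "A s x False \<noteq> 0" "A s x True \<noteq> 0"
      by blast
    then have *: "A s b y \<noteq> 0" "A s x b \<noteq> 0" for b by (cases b; simp)+
    from that(3) show ?thesis
    proof
      assume "v = lpos s"
      then show ?thesis using * by (intro exI[of _ False] exI[of _ y]) auto
    next
      assume "v = rpos s"
      then show ?thesis using * by (intro exI[of _ x] exI[of _ False]) auto
    qed
  qed
  obtain xq yq where q: "\<not> (u = lpos q \<and> xq)" "\<not> (u = rpos q \<and> yq)"
      "\<And>b. A q (xq \<or> u = lpos q \<and> b) (yq \<or> u = rpos q \<and> b) \<noteq> 0"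
    using line[OF pqr(2) mixed(1) u] by blast
  obtain yr where r: "\<forall>b. A r b yr \<noteq> 0"
    using line[OF pqr(3) mixed(2), of "lpos r"] by auto
  have "\<exists>x y. A s x y \<noteq> 0" if "s < 2 * k" for s
    using det[OF that] unfolding form_det_def by (metis mult_zero_left diff_zero)
  then obtain x0 y0 where xy0: "\<And>s. s < 2 * k \<Longrightarrow> A s (x0 s) (y0 s) \<noteq> 0"
    by metis
  \<comment> \<open>Base configuration: pair \<open>p\<close>, \<open>u\<close> and
    \<open>lpos r\<close> get bit 0, the partners of \<open>u\<close> and \<open>lpos r\<close> the
    bits found above, and every other pair selects a nonzero entry.\<close>
  define x y where "x = x0(p := False, q := xq, r := False)"
    and "y = y0(p := False, q := yq, r := yr)"
  define Z where "Z = lpos ` {s. s < 2 * k \<and> x s} \<union> rpos ` {s. s < 2 * k \<and> y s}"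
  have Z_iff: "lpos s \<in> Z \<longleftrightarrow> x s" "rpos s \<in> Z \<longleftrightarrow> y s" if "s < 2 * k" for s
    using that by (auto simp: Z_def)
  define D where "D = {lpos p, u, rpos p, lpos r}"
  define C where "C = c * (\<Prod>s\<in>{..<2 * k} - {p, q, r}. A s (lpos s \<in> Z) (rpos s \<in> Z))"
  have "C \<noteq> 0"
    unfolding C_def using c xy0 by (auto simp: Z_iff x_def y_def)
  define g where "g b = A q (xq \<or> u = lpos q \<and> b) (yq \<or> u = rpos q \<and> b)" for b
  have Z: "Z \<subseteq> {1..4 * k}" unfolding positions_eq by (auto simp: Z_def)
  have D: "D \<subseteq> {1..4 * k}" using pqr u by (auto simp: D_def)
  have ZD: "Z \<inter> D = {}"
    using u q(1,2) pqr by (auto simp: D_def Z_iff x_def y_def)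
  have prod: "t J = A p (lpos p \<in> J) (rpos p \<in> J) * (C * g (u \<in> J) * A r (lpos r \<in> J) yr)"
    if "J \<subseteq> {1..4 * k}" "even (card J)" "J - D = Z" for J
  proof -
    have mem: "i \<in> J \<longleftrightarrow> i \<in> Z" if "i \<notin> D" for i
      using that \<open>J - D = Z\<close> by blast
    then have "pair_product k c A J = (\<Prod>s\<in>{p, q, r}. A s (lpos s \<in> J) (rpos s \<in> J)) * C"
      unfolding C_def using pqr u by (intro pair_product_split) (auto simp: D_def)
    moreover have "rpos r \<in> J \<longleftrightarrow> yr"
      using mem[of "rpos r"] pqr u by (auto simp: D_def Z_iff y_def)
    moreover have "A q (lpos q \<in> J) (rpos q \<in> J) = g (u \<in> J)"
      using mem[of "lpos q"] mem[of "rpos q"] pqr u q(1,2)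
      by (auto simp: D_def Z_iff y_def x_def g_def)
    ultimately show ?thesis using T[OF that(1,2)] pqr by simp
  qed
  have nz: "g b \<noteq> 0" "A r b yr \<noteq> 0" for b
    using q(3) r by (auto simp: g_def)
  note cross = pfaffian_cone_crossing[OF t ord, of Z "A p" "\<lambda>a b. C * g a * A r b yr"]
  have "form_det (A p) * (C * g True * A r True yr * (C * g False * A r False yr)) = 0"
  proof (cases "even (card Z)")
    case True
    then show ?thesis
      using cross(1) prod D Z ZD unfolding D_def by (simp add: form_det_def algebra_simps)
  next
    case False
    then show ?thesis
      using cross(2) prod D Z ZD unfolding D_def by (auto simp: form_det_def algebra_simps)
  qed
  then show False
    using nz \<open>C \<noteq> 0\<close> det[OF pqr(1)] by simp
qed

text \<open>As \<open>k\<close> is at least 2, blocks 0 and 1 both exist. A nonzero coordinate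
  forces a mixed form in each of them, which \<open>mixed_crossing\<close> excludes.\<close>

lemma even_pair_product_not_in_cone:
  assumes k: "k \<ge> 2" and t: "t \<in> pfaffian_cone (4 * k)"
    and T: "\<And>I. I \<subseteq> {1..4 * k} \<Longrightarrow> even (card I) \<Longrightarrow> t I = pair_product k c A I"
    and c: "c \<noteq> 0" and det: "\<And>s. s < 2 * k \<Longrightarrow> form_det (A s) \<noteq> 0"
    and I: "I \<subseteq> {1..4 * k}" "even (card I)"
  shows "t I = 0"
proof (rule ccontr)
  assume nz: "t I \<noteq> 0"
  have mixed: "\<exists>q\<in>{2 * j, 2 * j + 1}. \<not> single_parity (A q)" if "j < k" for j
    using single_parity_block[OF t that T _ _ _ _ I] det nz that by fastforce
  obtain q where q: "q = 0 \<or> q = 1" "\<not> single_parity (A q)"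
    using mixed[of 0] k by auto
  obtain r where r: "r = 2 \<or> r = 3" "\<not> single_parity (A r)"
    using mixed[of 1] k by auto
  \<comment> \<open>The partner form \<open>1 - q\<close> occupies positions 2 and 4 if
    \<open>q = 0\<close>, and 1 and 3 if \<open>q = 1\<close>. Accordingly \<open>u\<close> is 3 or
    2, strictly between them, while \<open>lpos r\<close> is 5 or 6.\<close>
  define u where "u = (if q = 0 then rpos q else lpos q)"
  show False
    by (rule mixed_crossing[OF t T c det, of "1 - q" q r u])
      (use q r k in \<open>auto simp: u_def lpos_def rpos_def\<close>)
qed

section \<open>Orbits and their closures\<close>

lemma poly_fun_sum:
  "(\<And>x. x \<in> S \<Longrightarrow> poly_fun n (f x)) \<Longrightarrow> poly_fun n (\<lambda>t. \<Sum>x\<in>S. f x t)"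
  by (induction S rule: infinite_finite_induct) (simp_all add: poly_fun.const poly_fun.add)

lemma SWAP_apply:
  assumes "J \<subseteq> {1..4}"
  shows "SWAP J = of_bool ((1 \<in> J \<longleftrightarrow> 3 \<in> J) \<and> (2 \<in> J \<longleftrightarrow> 4 \<in> J))"
proof -
  have four: "{1..4} = {1, 2, 3, 4 :: nat}" by auto
  have "{1..length [a, b, c, d]} = {1, 2, 3, 4}" for a b c d :: nat by auto
  then have "bra_bits [0, 0, 0, 0] = bra {}" "bra_bits [0, 1, 0, 1] = bra {2, 4}"
    "bra_bits [1, 0, 1, 0] = bra {1, 3}" "bra_bits [1, 1, 1, 1] = bra {1, 2, 3, 4}"
    unfolding bra_bits_def by (auto intro!: arg_cong[of _ _ bra])
  then have "SWAP J = of_bool (J = {}) + of_bool (J = {2, 4}) + of_bool (J = {1, 3})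
      + of_bool (J = {1, 2, 3, 4})"
    by (simp add: SWAP_def bra_def)
  moreover have "J = S \<longleftrightarrow> (1 \<in> J \<longleftrightarrow> 1 \<in> S) \<and> (2 \<in> J \<longleftrightarrow> 2 \<in> S) \<and> (3 \<in> J \<longleftrightarrow> 3 \<in> S) \<and> (4 \<in> J \<longleftrightarrow> 4 \<in> S)"
    if "S \<subseteq> {1, 2, 3, 4}" for S
    using assms that unfolding four by blast
  ultimately show ?thesis by simp
qed

lemma lpos_add2: "lpos (Suc (Suc s)) = lpos s + 4"
  by (simp add: lpos_def)

lemma tensor_power_SWAP:
  assumes "J \<subseteq> {1..4 * k}"
  shows "tensor_power 4 SWAP k J = pair_product k 1 (\<lambda>s x y. of_bool (x = y)) J"
  using assms
proof (induction k arbitrary: J)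
  case 0
  then show ?case by (simp add: bra_def pair_product_def)
next
  case (Suc k)
  define J' where "J' = (\<lambda>i. i - 4) ` (J - {..4})"
  \<comment> \<open>The value \<open>i = 0\<close> is excluded because position 4 belongs to the
    first copy: 0 never lies in \<open>J'\<close>, even when 4 is in \<open>J\<close>.\<close>
  have mem: "i \<in> J' \<longleftrightarrow> i + 4 \<in> J" if "i \<ge> 1" for i
    using that by (force simp: J'_def image_iff)
  have J': "J' \<subseteq> {1..4 * k}"
  proof
    fix i assume "i \<in> J'"
    then obtain l where "l \<in> J" "l \<notin> {..4}" "i = l - 4" unfolding J'_def by blast
    with Suc.prems show "i \<in> {1..4 * k}" by auto
  qed
  have low: "J \<inter> {..4} \<subseteq> {1..4}" using Suc.prems by auto
  have shift: "(\<Prod>s<2 * Suc k. h s) = h 0 * (h 1 * (\<Prod>s<2 * k. h (Suc (Suc s))))"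
    for h :: "nat \<Rightarrow> complex"
    by (simp add: prod.lessThan_Suc_shift del: prod.lessThan_Suc)
  have pos: "lpos 0 = 1" "rpos 0 = 3" "lpos 1 = 2" "rpos 1 = 4"
    by (simp_all add: lpos_def rpos_def)
  have "(\<Prod>s<2 * k. of_bool ((lpos s \<in> J') = (rpos s \<in> J')))
      = (\<Prod>s<2 * k. of_bool ((lpos (Suc (Suc s)) \<in> J) = (rpos (Suc (Suc s)) \<in> J)) :: complex)"
    by (simp add: mem lpos_add2 rpos_def lpos_def)
  then have "pair_product (Suc k) 1 (\<lambda>s x y. of_bool (x = y)) J =
      of_bool ((1 \<in> J) = (3 \<in> J)) * (of_bool ((2 \<in> J) = (4 \<in> J))
        * pair_product k 1 (\<lambda>s x y. of_bool (x = y)) J')"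
    unfolding pair_product_def shift pos by simp
  also have "\<dots> = SWAP (J \<inter> {..4}) * tensor_power 4 SWAP k J'"
    unfolding SWAP_apply[OF low] Suc.IH[OF J'] by simp
  finally show ?case by (simp add: tensor_prod_def J'_def)
qed

text \<open>The forms making up SWAP are identity matrices, so the form of pair \<open>s\<close>
  becomes the transposed inverse at \<open>lpos s\<close> times the inverse at
  \<open>rpos s\<close>; \<open>sum_Pow_pairs\<close> separates the pairs.\<close>

lemma act_SWAP:
  fixes g :: "nat \<Rightarrow> complex^2^2"
  defines "h \<equiv> (\<lambda>i (z::bool) (x::bool). matrix_inv (g i) $ of_bool z $ of_bool x)"
  assumes I: "I \<subseteq> {1..4 * k}"
  shows "act (4 * k) g (tensor_power 4 SWAP k) I =
    pair_product k 1 (\<lambda>s x y. \<Sum>z\<in>UNIV. h (lpos s) z x * h (rpos s) z y) I"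
proof -
  have "act (4 * k) g (tensor_power 4 SWAP k) I =
      (\<Sum>J\<in>Pow {1..4 * k}. tensor_power 4 SWAP k J * (\<Prod>i\<in>{1..4 * k}. h i (i \<in> J) (i \<in> I)))"
    using I by (simp add: act_def h_def)
  also have "\<dots> = (\<Sum>J\<in>Pow {1..4 * k}. \<Prod>s<2 * k. of_bool ((lpos s \<in> J) = (rpos s \<in> J)) *
      (h (lpos s) (lpos s \<in> J) (lpos s \<in> I) * h (rpos s) (rpos s \<in> J) (rpos s \<in> I)))"
    by (intro sum.cong refl)
      (simp add: tensor_power_SWAP prod_positions pair_product_def prod.distrib del: One_nat_def)
  also have "\<dots> = (\<Prod>s<2 * k. \<Sum>z\<in>UNIV. \<Sum>w\<in>UNIV. of_bool (z = w) *
      (h (lpos s) z (lpos s \<in> I) * h (rpos s) w (rpos s \<in> I)))"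
    unfolding positions_eq
    using sum_Pow_pairs[of "{..<2 * k}" "\<lambda>s z w. of_bool (z = w) *
      (h (lpos s) z (lpos s \<in> I) * h (rpos s) w (rpos s \<in> I))"] by simp
  also have "\<dots> = pair_product k 1 (\<lambda>s x y. \<Sum>z\<in>UNIV. h (lpos s) z x * h (rpos s) z y) I"
    by (simp add: pair_product_def UNIV_bool)
  finally show ?thesis .
qed

lemma det_two: "det (A :: complex^2^2) = A $ 0 $ 0 * A $ 1 $ 1 - A $ 0 $ 1 * A $ 1 $ 0"
proof -
  \<comment> \<open>\<open>det_2\<close> labels the indices 1 and 2, here they are 1 and 0.
    Relabelling rows and columns together preserves the determinant.\<close>
  have "(2::2) = 0" by simp
  then show ?thesis by (simp only: det_2) (simp add: mult.commute)
qed

lemma det_matrix_inv: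
  fixes A :: "complex^2^2"
  assumes "det A \<noteq> 0"
  shows "det (matrix_inv A) = inverse (det A)"
proof -
  have "A ** matrix_inv A = mat 1"
  proof -
    have "\<exists>B. A ** B = mat 1 \<and> B ** A = mat 1"
      using assms by (simp add: invertible_det_nz flip: invertible_def)
    from someI_ex[OF this] show ?thesis by (simp add: matrix_inv_def)
  qed
  then have "det A * det (matrix_inv A) = 1"
    by (metis det_mul det_I)
  then show ?thesis by (simp add: inverse_unique)
qed

text \<open>A general \<open>H\<close> covers \<open>GL2\<close> and \<open>SL2\<close> at once. The
  exact determinants, rather than only their being nonzero, make \<open>skew_form\<close> constant
  on the \<open>SL2\<close> orbit.\<close>

lemma orbit_SWAP:
  assumes "T \<in> orbit (4 * k) H (tensor_power 4 SWAP k)" and H: "\<And>A. A \<in> H \<Longrightarrow> det A \<noteq> 0"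
  obtains A where "\<And>I. I \<subseteq> {1..4 * k} \<Longrightarrow> T I = pair_product k 1 A I"
    and "\<And>s. s < 2 * k \<Longrightarrow> \<exists>B\<in>H. \<exists>C\<in>H. form_det (A s) = inverse (det B * det C)"
proof -
  obtain g where g: "\<forall>i\<in>{1..4 * k}. g i \<in> H"
    and T: "T = act (4 * k) g (tensor_power 4 SWAP k)"
    using assms(1) unfolding orbit_def by blast
  define h where "h i z x = matrix_inv (g i) $ of_bool z $ of_bool x" for i and z x :: bool
  define A where "A s x y = (\<Sum>z\<in>UNIV. h (lpos s) z x * h (rpos s) z y)" for s x y
  show ?thesis
  proof
    show "T I = pair_product k 1 A I" if "I \<subseteq> {1..4 * k}" for I
      unfolding T A_def h_def using act_SWAP[OF that] by simp
    show "\<exists>B\<in>H. \<exists>C\<in>H. form_det (A s) = inverse (det B * det C)" if "s < 2 * k" for s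
    proof -
      have in_H: "g (lpos s) \<in> H" "g (rpos s) \<in> H"
        using that g by auto
      have "form_det (A s) = det (matrix_inv (g (lpos s))) * det (matrix_inv (g (rpos s)))"
        by (simp add: form_det_def A_def h_def UNIV_bool det_two algebra_simps)
      then have "form_det (A s) = inverse (det (g (lpos s)) * det (g (rpos s)))"
        using in_H[THEN H] by (simp add: det_matrix_inv)
      with in_H show ?thesis by blast
    qed
  qed
qed

text \<open>This quadratic form is invariant under \<open>SL2\<close> in every tensor factor; since it does not
  vanish on the orbit, no factor of a tensor in the closure can degenerate.\<close>

definition skew_form :: "nat \<Rightarrow> tensor \<Rightarrow> complex" where
  "skew_form n t = (\<Sum>I\<in>Pow {1..n}. (-1) ^ card I * (t I * t ({1..n} - I)))"

lemma poly_fun_skew_form: "poly_fun n (skew_form n)"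
  unfolding skew_form_def[abs_def]
  by (intro poly_fun_sum poly_fun.mult poly_fun.const poly_fun.coord) auto

text \<open>Sign and complement both split over the positions, so the sum factors over the pairs.
  The four bit choices in one pair give each of the two products in \<open>form_det\<close>
  twice.\<close>

lemma skew_form_pair_product:
  assumes t: "\<And>I. I \<subseteq> {1..4 * k} \<Longrightarrow> t I = pair_product k c A I"
  shows "skew_form (4 * k) t = c\<^sup>2 * (\<Prod>s<2 * k. 2 * form_det (A s))"
proof -
  define e :: "bool \<Rightarrow> complex" where "e b = (if b then -1 else 1)" for b
  have sign: "(-1) ^ card I = (\<Prod>s<2 * k. e (lpos s \<in> I) * e (rpos s \<in> I))" if "I \<subseteq> {1..4 * k}" for I
  proof -
    have "(\<Prod>i\<in>{1..4 * k}. e (i \<in> I)) = (\<Prod>i\<in>I. -1)"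
      unfolding e_def using that by (simp add: prod.If_cases Int_absorb1)
    then show ?thesis by (simp add: prod_positions del: One_nat_def)
  qed
  have "skew_form (4 * k) t = (\<Sum>I\<in>Pow {1..4 * k}. c\<^sup>2 * (\<Prod>s<2 * k. e (lpos s \<in> I) * e (rpos s \<in> I) *
      (A s (lpos s \<in> I) (rpos s \<in> I) * A s (lpos s \<notin> I) (rpos s \<notin> I))))"
    unfolding skew_form_def
  proof (intro sum.cong refl)
    fix I assume "I \<in> Pow {1..4 * k}"
    then have I: "I \<subseteq> {1..4 * k}" by simp
    have "t ({1..4 * k} - I) = c * (\<Prod>s<2 * k. A s (lpos s \<notin> I) (rpos s \<notin> I))"
      by (subst t) (auto simp: pair_product_def intro!: prod.cong)
    then show "(-1) ^ card I * (t I * t ({1..4 * k} - I)) =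
      c\<^sup>2 * (\<Prod>s<2 * k. e (lpos s \<in> I) * e (rpos s \<in> I) *
      (A s (lpos s \<in> I) (rpos s \<in> I) * A s (lpos s \<notin> I) (rpos s \<notin> I)))"
      using t[OF I] by (simp add: sign[OF I] pair_product_def prod.distrib power2_eq_square)
  qed
  also have "\<dots> = c\<^sup>2 * (\<Prod>s<2 * k. \<Sum>x\<in>UNIV. \<Sum>y\<in>UNIV. e x * e y * (A s x y * A s (\<not> x) (\<not> y)))"
    unfolding positions_eq sum_distrib_left[symmetric]
    using sum_Pow_pairs[of "{..<2 * k}" "\<lambda>s x y. e x * e y * (A s x y * A s (\<not> x) (\<not> y))"] by simp
  also have "\<dots> = c\<^sup>2 * (\<Prod>s<2 * k. 2 * form_det (A s))"
    by (simp add: UNIV_bool e_def form_det_def algebra_simps)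
  finally show ?thesis .
qed

definition graft :: "nat set \<Rightarrow> nat set \<Rightarrow> nat set \<Rightarrow> nat set" where
  "graft P I J = (I \<inter> P) \<union> (J - P)"

text \<open>At pair \<open>s\<close> the two factors keep their order, at every other pair they are
  interchanged.\<close>

lemma pair_product_exchange:
  assumes "s < 2 * k"
  defines "P \<equiv> {lpos s, rpos s}"
  shows "pair_product k c A I * pair_product k c A J =
    pair_product k c A (graft P I J) * pair_product k c A (graft P J I)"
proof -
  have "A r (lpos r \<in> I) (rpos r \<in> I) * A r (lpos r \<in> J) (rpos r \<in> J) =
    A r (lpos r \<in> graft P I J) (rpos r \<in> graft P I J) * A r (lpos r \<in> graft P J I) (rpos r \<in> graft P J I)" for r
    by (cases "r = s") (simp_all add: P_def graft_def)
  then show ?thesis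
    by (simp add: pair_product_def prod.distrib[symmetric] algebra_simps)
qed

text \<open>The exchange relations of \<open>pair_product_exchange\<close> are the equations of a Segre variety.\<close>

lemma closure_pair_product:
  assumes t: "t \<in> zariski_closure (4 * k) X" and "c0 \<noteq> 0"
    and X: "\<And>T. T \<in> X \<Longrightarrow> \<exists>c A. \<forall>I \<subseteq> {1..4 * k}. T I = pair_product k c A I"
    and form: "\<And>T. T \<in> X \<Longrightarrow> skew_form (4 * k) T = c0"
  obtains c A where "\<And>I. I \<subseteq> {1..4 * k} \<Longrightarrow> t I = pair_product k c A I"
    and "c \<noteq> 0" and "\<And>s. s < 2 * k \<Longrightarrow> form_det (A s) \<noteq> 0"
proof -
  have vanish: "f t = 0" if "poly_fun (4 * k) f" "\<And>T. T \<in> X \<Longrightarrow> f T = 0" for f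
    using t that by (auto simp: zariski_closure_def)
  have form_t: "skew_form (4 * k) t = c0"
    using vanish[OF poly_fun.add[OF poly_fun_skew_form poly_fun.const[of _ "- c0"]]] form by simp
  have graft_sub: "graft P I J \<subseteq> {1..4 * k}" if "I \<subseteq> {1..4 * k}" "J \<subseteq> {1..4 * k}" for P I J
    using that by (auto simp: graft_def)
  have exchange: "t I * t J = t (graft {lpos s, rpos s} I J) * t (graft {lpos s, rpos s} J I)"
    if s: "s < 2 * k" and IJ: "I \<subseteq> {1..4 * k}" "J \<subseteq> {1..4 * k}" for s I J
  proof -
    have "t I * t J + (-1) * (t (graft {lpos s, rpos s} I J) * t (graft {lpos s, rpos s} J I)) = 0"
    proof (rule vanish)
      show "poly_fun (4 * k) (\<lambda>t. t I * t J
          + (-1) * (t (graft {lpos s, rpos s} I J) * t (graft {lpos s, rpos s} J I)))"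
        using IJ by (intro poly_fun.add poly_fun.mult poly_fun.const poly_fun.coord graft_sub)
      fix T assume "T \<in> X"
      from X[OF this] obtain c A where "\<And>I. I \<subseteq> {1..4 * k} \<Longrightarrow> T I = pair_product k c A I" by blast
      then show "T I * T J
          + (-1) * (T (graft {lpos s, rpos s} I J) * T (graft {lpos s, rpos s} J I)) = 0"
        using IJ pair_product_exchange[OF s, of c A I J] by (simp add: graft_sub del: One_nat_def)
    qed
    then show ?thesis by simp
  qed
  have "\<exists>I0 \<in> Pow {1..4 * k}. t I0 \<noteq> 0"
  proof (rule ccontr)
    assume "\<not> ?thesis"
    then have "skew_form (4 * k) t = 0"
      unfolding skew_form_def by (intro sum.neutral) auto
    with form_t \<open>c0 \<noteq> 0\<close> show False by simp
  qed
  then obtain I0 where I0: "I0 \<subseteq> {1..4 * k}" "t I0 \<noteq> 0" by blast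
  \<comment> \<open>Factors normalised at the base point \<open>I0\<close>: an entry compares
    \<open>t I0\<close> with the coordinate obtained by changing only the bits of pair
    \<open>s\<close>.\<close>
  define A where "A s x y = t (graft {lpos s, rpos s}
    ((if x then {lpos s} else {}) \<union> (if y then {rpos s} else {})) I0) / t I0" for s x y
  have A: "A s (lpos s \<in> I) (rpos s \<in> I) = t (graft {lpos s, rpos s} I I0) / t I0" for s I
  proof -
    have "graft {lpos s, rpos s} ((if lpos s \<in> I then {lpos s} else {})
        \<union> (if rpos s \<in> I then {rpos s} else {})) I0 = graft {lpos s, rpos s} I I0"
      by (auto simp: graft_def)
    then show ?thesis by (simp add: A_def)
  qed
  have prod: "t I = pair_product k (t I0) A I" if I: "I \<subseteq> {1..4 * k}" for I
  proof -
    \<comment> \<open>Pairs are switched from \<open>I0\<close> to \<open>I\<close> one at a time;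
      the exchange with \<open>I0\<close> at the new pair contributes exactly its factor
      \<open>A s\<close>.\<close>
    have "t (graft (lpos ` S \<union> rpos ` S) I I0) = t I0 * (\<Prod>s\<in>S. A s (lpos s \<in> I) (rpos s \<in> I))"
      if "finite S" "S \<subseteq> {..<2 * k}" for S
      using that
    proof (induction S)
      case empty
      then show ?case by (simp add: graft_def)
    next
      case (insert s S)
      define P where "P = {lpos s, rpos s}"
      define M where "M = graft (lpos ` insert s S \<union> rpos ` insert s S) I I0"
      have "t M * t I0 = t (graft P M I0) * t (graft P I0 M)"
        unfolding P_def using insert.prems I0 graft_sub[OF I I0(1)] by (intro exchange) (auto simp: M_def)
      moreover have "graft P M I0 = graft P I I0"
        by (auto simp: P_def M_def graft_def)
      moreover have "graft P I0 M = graft (lpos ` S \<union> rpos ` S) I I0"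
        using insert.hyps by (auto simp: P_def M_def graft_def)
      ultimately have "t M * t I0 = t (graft P I I0) * (t I0 * (\<Prod>s\<in>S. A s (lpos s \<in> I) (rpos s \<in> I)))"
        using insert by simp
      then have "t M = t I0 * (A s (lpos s \<in> I) (rpos s \<in> I) * (\<Prod>s\<in>S. A s (lpos s \<in> I) (rpos s \<in> I)))"
        unfolding A P_def using I0 by (simp add: field_simps)
      then show ?case using insert.hyps by (simp add: M_def)
    qed
    from this[of "{..<2 * k}"]
    have "t (graft {1..4 * k} I I0) = t I0 * (\<Prod>s<2 * k. A s (lpos s \<in> I) (rpos s \<in> I))"
      unfolding positions_eq by simp
    moreover have "graft {1..4 * k} I I0 = I"
      using I I0 by (auto simp: graft_def)
    ultimately show ?thesis by (simp add: pair_product_def)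
  qed
  have "(t I0)\<^sup>2 * (\<Prod>s<2 * k. 2 * form_det (A s)) \<noteq> 0"
    using skew_form_pair_product[OF prod] form_t \<open>c0 \<noteq> 0\<close> by simp
  then show ?thesis
    using that[OF prod] I0 by simp
qed

section \<open>Emptiness of both intersections\<close>

lemma even_proj_pair_product_not_in_cone:
  assumes k: "k \<ge> 2" and c: "c \<noteq> 0" and det: "\<And>s. s < 2 * k \<Longrightarrow> form_det (A s) \<noteq> 0"
    and T: "\<And>I. I \<subseteq> {1..4 * k} \<Longrightarrow> T I = pair_product k c A I"
  shows "even_proj T \<notin> pfaffian_cone (4 * k) - {\<lambda>I. 0}"
proof
  assume *: "even_proj T \<in> pfaffian_cone (4 * k) - {\<lambda>I. 0}"
  then have "even_proj T I = 0" if "I \<subseteq> {1..4 * k}" "even (card I)" for I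
    using that T by (intro even_pair_product_not_in_cone[OF k _ _ c det]) (auto simp: even_proj_def)
  moreover have "even_proj T I = 0" if "\<not> I \<subseteq> {1..4 * k}" for I
    using * that unfolding pfaffian_cone_def tensor_space_def by blast
  ultimately have "even_proj T = (\<lambda>I. 0)"
    by (metis even_proj_def ext)
  with * show False by simp
qed

theorem theorem4p7:
  fixes k n :: nat and G :: tensor
  assumes "k \<ge> 2" and "n = 4 * k" and "G = tensor_power 4 SWAP k"
  shows "even_proj ` zariski_closure n (orbit n SL2 G) \<inter> (pfaffian_cone n - {\<lambda>I. 0})
           = even_proj ` orbit n GL2 G \<inter> pfaffian_punctured_lines n
       \<and> even_proj ` orbit n GL2 G \<inter> pfaffian_punctured_lines n = {}"
proof -
  have "even_proj T \<notin> pfaffian_cone n - {\<lambda>I. 0}" if "T \<in> orbit n GL2 G" for T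
  proof -
    have "det B \<noteq> 0" if "B \<in> GL2" for B
      using that by (simp add: GL2_def invertible_det_nz)
    then obtain A where "\<And>I. I \<subseteq> {1..4 * k} \<Longrightarrow> T I = pair_product k 1 A I"
      and "\<And>s. s < 2 * k \<Longrightarrow> form_det (A s) \<noteq> 0"
      using orbit_SWAP[OF \<open>T \<in> orbit n GL2 G\<close>[unfolded assms(2,3)]]
      by (metis inverse_nonzero_iff_nonzero mult_eq_0_iff)
    then show ?thesis
      unfolding assms(2) using assms(1)
      by (intro even_proj_pair_product_not_in_cone[of k 1 A]) auto
  qed
  then have GL: "even_proj ` orbit n GL2 G \<inter> pfaffian_punctured_lines n = {}"
    using pfaffian_punctured_lines_subset by blast
  have "even_proj t \<notin> pfaffian_cone n - {\<lambda>I. 0}" if t: "t \<in> zariski_closure n (orbit n SL2 G)" for t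
  proof -
    \<comment> \<open>Over \<open>SL2\<close> every pair form has determinant 1, so
      \<open>skew_form\<close> has the constant value \<open>2 ^ (2 * k)\<close>; as a polynomial
      condition this passes to the closure.\<close>
    have SL: "\<exists>c A. (\<forall>I \<subseteq> {1..4 * k}. T I = pair_product k c A I)"
      "skew_form (4 * k) T = 2 ^ (2 * k)" if T: "T \<in> orbit n SL2 G" for T
    proof -
      have "det B \<noteq> 0" if "B \<in> SL2" for B
        using that by (simp add: SL2_def)
      then obtain A where A: "\<And>I. I \<subseteq> {1..4 * k} \<Longrightarrow> T I = pair_product k 1 A I"
        and "\<And>s. s < 2 * k \<Longrightarrow> \<exists>B\<in>SL2. \<exists>C\<in>SL2. form_det (A s) = inverse (det B * det C)"
        using orbit_SWAP[OF T[unfolded assms(2,3)]] by metis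
      then have "form_det (A s) = 1" if "s < 2 * k" for s
        using that by (fastforce simp: SL2_def)
      with skew_form_pair_product[OF A] show "skew_form (4 * k) T = 2 ^ (2 * k)" by simp
      show "\<exists>c A. (\<forall>I \<subseteq> {1..4 * k}. T I = pair_product k c A I)" using A by blast
    qed
    obtain c A where "\<And>I. I \<subseteq> {1..4 * k} \<Longrightarrow> t I = pair_product k c A I"
      and "c \<noteq> 0" and "\<And>s. s < 2 * k \<Longrightarrow> form_det (A s) \<noteq> 0"
      by (rule closure_pair_product[OF t[unfolded assms(2)], of "2 ^ (2 * k)"])
        (use SL assms(2) in auto)
    then show ?thesis
      unfolding assms(2) using assms(1) by (intro even_proj_pair_product_not_in_cone[of k c A]) auto
  qed
  then have "even_proj ` zariski_closure n (orbit n SL2 G) \<inter> (pfaffian_cone n - {\<lambda>I. 0}) = {}"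
    by blast
  with GL show ?thesis by simp
qed

end
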